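(* For every integer $n\ge 0$ let $\overline{W_n}$ be the $n$-twist bracelet with generating polynomial $\overline{W_n}(x)$, and let $W_n(x)$ be the generating polynomial of the $n$-twist link $W_n$. Then $$\overline{W_n}(x)=(x+2)\,\overline{W_{n-1}}(x)+(2x+3)\,W_{n-1}(x)\qquad (n\ge 1),$$ and $\overline{W_n}(x)$ is given by the closed form $$\overline{W_n}(x)=\left(2x^2+4x+2\right)^n+\left(x^2-1\right)(x+2)^n\qquad (n\ge 0).$$
   Context: A knot (diagram) means a shadow on the sphere $S^2$: a finite collection of closed curves whose only singularities are finitely many transverse double points, called crossings, with no over/under information, considered up to planar isotopy (several components and crossingless circles are allowed). The unknot $U$ is a single simple closed curve. Each crossing can be split in two ways: remove the crossing and reconnect the four ends in one of the two planar non-crossing ways that join adjacent ends (type $0$ and type $1$ splits). A state of a knot $K$ with $m$ crossings is one of the $2^m$ diagrams obtained by choosing a split at each crossing; it is a disjoint union of simple closed curves (circles), and $|S|$ denotes the number of circles of the state $S$. The generating polynomial of $K$ is $K(x)=\sum_S x^{|S|}$, summed over all $2^m$ states. Consider diagrams in a disc with four boundary ends NW, SW (left) and NE, SE (right); two such diagrams are put side by side by joining the NE and SE ends of the first to the NW and SW ends of the second. The Hopf block consists of two crossings stacked vertically: the two upper ends of the top crossing are NW and NE, its two lower ends are joined to the two upper ends of the bottom crossing (left to left, right to right), and the two lower ends of the bottom crossing are SW and SE. The twist block is a single crossing whose four ends are NW, SW, NE, SE. The twist-link block is a Hopf block and a twist block side by side. Put $n$ twist-link blocks side by side; for $n=0$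 take two disjoint horizontal strands NW–NE and SW–SE. The $n$-twist link $W_n$ is obtained from this diagram by joining, outside the disc and without crossings, NW to SW and NE to SE (so $W_0=U$ and $W_1$ is the Hopf link with one half twist added). The $n$-twist bracelet $\overline{W_n}$, the closure of $W_n$, is obtained by instead joining, outside the disc by disjoint simple arcs, NW to NE and SW to SE ($\overline{W_0}$ is two disjoint circles). *)

theory Defs
  imports "HOL-Computational_Algebra.Polynomial"
begin

section \<open>Diagrams, splits and states\<close>

text \<open>
  A shadow is encoded by finitely many marked points on its curves, named by natural numbers.
  A crossing is the quadruple of its four ends in the cyclic order in which they leave the double
  point. An arc \<open>(p, q)\<close> is a crossingless piece of curve between the marked points \<open>p\<close> and \<open>q\<close>.
  The order of the two lists, and the orientation of an arc, carry no meaning. A crossingless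
  circle is a cycle of arcs. The embedding in the sphere enters only through the cyclic orders at
  the crossings, which determine the two planar splits; planarity itself is not recorded, since
  states and their circles do not refer to it.
\<close>

type_synonym crossing = "nat \<times> nat \<times> nat \<times> nat"

datatype diagram = Diagram (arcs: "(nat \<times> nat) list") (crossings: "crossing list")

text \<open>Each marked point, once for every arc end and every crossing end located at it.\<close>

definition ends :: "diagram \<Rightarrow> nat list" where
  "ends D = concat (map (\<lambda>(p, q). [p, q]) (arcs D))
          @ concat (map (\<lambda>(a, b, c, d). [a, b, c, d]) (crossings D))"

definition points :: "diagram \<Rightarrow> nat set" where
  "points D = set (ends D)"

text \<open>
  The diagram of a collection of closed curves: exactly two ends meet at each marked point.
\<close>

definition closed_diagram :: "diagram \<Rightarrow> bool" where
  "closed_diagram D \<longleftrightarrow> (\<forall>p \<in> points D. count_list (ends D) p = 2)"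

text \<open>
  Both splits join cyclically adjacent ends; which one is called type 0 depends on the end listed
  first and does not affect the sum over all states.
\<close>

datatype split = Split0 | Split1

fun split_crossing :: "split \<Rightarrow> crossing \<Rightarrow> (nat \<times> nat) list" where
  "split_crossing Split0 (a, b, c, d) = [(a, b), (c, d)]"
| "split_crossing Split1 (a, b, c, d) = [(b, c), (d, a)]"

definition split_choices :: "diagram \<Rightarrow> split list set" where
  "split_choices D = {s. length s = length (crossings D)}"

definition state :: "diagram \<Rightarrow> split list \<Rightarrow> diagram" where
  "state D s = Diagram (arcs D @ concat (map2 split_crossing s (crossings D))) []"

definition connected_points :: "diagram \<Rightarrow> (nat \<times> nat) set" where
  "connected_points D = {(p, q). p \<in> points D \<and> q \<in> points D \<and>
     (p, q) \<in> (set (arcs D) \<union> (set (arcs D))\<inverse>)\<^sup>*}"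

text \<open>
  Two arc ends meet at each point of a state of a closed diagram, so the circles of the state are
  the connected components of the graph formed by its points and arcs.
\<close>

definition circles :: "diagram \<Rightarrow> nat" where
  "circles S = card (points S // connected_points S)"

definition generating_poly :: "diagram \<Rightarrow> int poly" where
  "generating_poly D = (\<Sum>s \<in> split_choices D. monom 1 (circles (state D s)))"


section \<open>Diagrams in a disc with four boundary ends\<close>

text \<open>The four corners are marked points of the body at which only one end is located.\<close>

datatype tangle = Tangle (body: diagram) (NW: nat) (NE: nat) (SW: nat) (SE: nat)

definition rename :: "(nat \<Rightarrow> nat) \<Rightarrow> tangle \<Rightarrow> tangle" where
  "rename f T = Tangle
     (Diagram (map (\<lambda>(p, q). (f p, f q)) (arcs (body T)))
              (map (\<lambda>(a, b, c, d). (f a, f b, f c, f d)) (crossings (body T))))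
     (f (NW T)) (f (NE T)) (f (SW T)) (f (SE T))"

definition add_arcs :: "(nat \<times> nat) list \<Rightarrow> diagram \<Rightarrow> diagram" where
  "add_arcs as D = Diagram (as @ arcs D) (crossings D)"

definition union_diagram :: "diagram \<Rightarrow> diagram \<Rightarrow> diagram" where
  "union_diagram D E = Diagram (arcs D @ arcs E) (crossings D @ crossings E)"

text \<open>
  Points of the first tangle become even and points of the second become odd, so that the two
  tangles are disjoint before they are joined.
\<close>

definition beside :: "tangle \<Rightarrow> tangle \<Rightarrow> tangle" where
  "beside S T = (let L = rename (\<lambda>p. 2 * p) S; R = rename (\<lambda>p. 2 * p + 1) T in
     Tangle (add_arcs [(NE L, NW R), (SE L, SW R)] (union_diagram (body L) (body R)))
       (NW L) (NE R) (SW L) (SE R))"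

definition atop :: "tangle \<Rightarrow> tangle \<Rightarrow> tangle" where
  "atop S T = (let A = rename (\<lambda>p. 2 * p) S; B = rename (\<lambda>p. 2 * p + 1) T in
     Tangle (add_arcs [(SW A, NW B), (SE A, NE B)] (union_diagram (body A) (body B)))
       (NW A) (NE A) (SW B) (SE B))"

definition horizontal_strands :: tangle where
  "horizontal_strands = Tangle (Diagram [(0, 1), (3, 2)] []) 0 1 3 2"

text \<open>The ends of the crossing are listed in the cyclic order NW, NE, SE, SW.\<close>

definition twist_block :: tangle where
  "twist_block = Tangle (Diagram [] [(0, 1, 2, 3)]) 0 1 3 2"

definition Hopf_block :: tangle where
  "Hopf_block = atop twist_block twist_block"

definition twist_link_block :: tangle where
  "twist_link_block = beside Hopf_block twist_block"

text \<open>
  Starting from the horizontal strands also for positive \<open>n\<close> merely prolongs the two left ends of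
  the first block.
\<close>

primrec twist_link_blocks :: "nat \<Rightarrow> tangle" where
  "twist_link_blocks 0 = horizontal_strands"
| "twist_link_blocks (Suc n) = beside (twist_link_blocks n) twist_link_block"

definition twist_link :: "nat \<Rightarrow> diagram" where
  "twist_link n = (let T = twist_link_blocks n in
     add_arcs [(NW T, SW T), (NE T, SE T)] (body T))"

definition twist_bracelet :: "nat \<Rightarrow> diagram" where
  "twist_bracelet n = (let T = twist_link_blocks n in
     add_arcs [(NW T, NE T), (SW T, SE T)] (body T))"


section \<open>Well-formedness\<close>

text \<open>
  The links, the bracelets and all their states are indeed diagrams of closed curves.
\<close>

definition proper_tangle :: "tangle \<Rightarrow> bool" where
  "proper_tangle T \<longleftrightarrow> distinct [NW T, NE T, SW T, SE T] \<and>
     {NW T, NE T, SW T, SE T} \<subseteq> points (body T) \<and>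
     (\<forall>p \<in> points (body T). count_list (ends (body T)) p =
        (if p \<in> {NW T, NE T, SW T, SE T} then 1 else 2))"

lemma ends_rename: "ends (body (rename f T)) = map f (ends (body T))"
  by (auto simp: ends_def rename_def map_concat comp_def case_prod_unfold)

lemma corners_rename [simp]:
  "NW (rename f T) = f (NW T)" "NE (rename f T) = f (NE T)"
  "SW (rename f T) = f (SW T)" "SE (rename f T) = f (SE T)"
  by (simp_all add: rename_def)

lemma count_list_append': "count_list (xs @ ys) p = count_list xs p + count_list ys p"
  by (induction xs) auto

lemma count_ends_union:
  "count_list (ends (union_diagram D E)) p = count_list (ends D) p + count_list (ends E) p"
  by (simp add: ends_def union_diagram_def count_list_append')

lemma count_ends_add_arcs:
  "count_list (ends (add_arcs as D)) p =
     count_list (concat (map (\<lambda>(p, q). [p, q]) as)) p + count_list (ends D) p"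
  by (simp add: ends_def add_arcs_def count_list_append')

lemma count_even:
  fixes q :: nat
  shows "count_list (map (\<lambda>p. 2 * p) xs) q = (if even q then count_list xs (q div 2) else 0)"
proof (induction xs)
  case (Cons x xs)
  have "2 * x = q \<longleftrightarrow> even q \<and> x = q div 2"
    by presburger
  with Cons show ?case
    by simp
qed simp

lemma count_odd:
  fixes q :: nat
  shows "count_list (map (\<lambda>p. 2 * p + 1) xs) q = (if odd q then count_list xs (q div 2) else 0)"
proof (induction xs)
  case (Cons x xs)
  have "2 * x + 1 = q \<longleftrightarrow> odd q \<and> x = q div 2"
    by presburger
  with Cons show ?case
    by simp
qed simp

lemma closed_diagram_iff: "closed_diagram D \<longleftrightarrow> (\<forall>p. count_list (ends D) p \<in> {0, 2})"
  by (auto simp: closed_diagram_def points_def count_list_0_iff)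

lemma proper_tangle_iff:
  "proper_tangle T \<longleftrightarrow> distinct [NW T, NE T, SW T, SE T] \<and>
     (\<forall>p. if p \<in> {NW T, NE T, SW T, SE T} then count_list (ends (body T)) p = 1
          else count_list (ends (body T)) p \<in> {0, 2})"
proof -
  define C where "C = {NW T, NE T, SW T, SE T}"
  have points: "points (body T) = {p. count_list (ends (body T)) p \<noteq> 0}"
    by (auto simp: points_def count_list_0_iff)
  have "C \<subseteq> points (body T) \<and>
      (\<forall>p \<in> points (body T). count_list (ends (body T)) p = (if p \<in> C then 1 else 2)) \<longleftrightarrow>
    (\<forall>p. if p \<in> C then count_list (ends (body T)) p = 1
          else count_list (ends (body T)) p \<in> {0, 2})"
    unfolding points by (auto split: if_splits) (metis less_irrefl)
  then show ?thesis
    unfolding proper_tangle_def C_def by (rule arg_cong)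
qed

lemma proper_tangle_glue:
  assumes "proper_tangle S" "proper_tangle T"
  shows "proper_tangle (beside S T)" "proper_tangle (atop S T)"
proof -
  define cS where "cS = count_list (ends (body S))"
  define cT where "cT = count_list (ends (body T))"
  obtain a b c d where S: "NW S = a" "NE S = b" "SW S = c" "SE S = d" by simp
  obtain a' b' c' d' where T: "NW T = a'" "NE T = b'" "SW T = c'" "SE T = d'" by simp
  have dS: "distinct [a, b, c, d]" and dT: "distinct [a', b', c', d']"
    using assms by (simp_all add: proper_tangle_iff S T)
  have nS: "cS a = 1" "cS b = 1" "cS c = 1" "cS d = 1"
    and nT: "cT a' = 1" "cT b' = 1" "cT c' = 1" "cT d' = 1"
    using assms by (auto simp: proper_tangle_iff S T cS_def cT_def)
  have iS: "cS p = 0 \<or> cS p = 2" if "p \<noteq> a" "p \<noteq> b" "p \<noteq> c" "p \<noteq> d" for p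
    using assms(1) that by (auto simp: proper_tangle_iff S cS_def split: if_splits)
  have iT: "cT p = 0 \<or> cT p = 2" if "p \<noteq> a'" "p \<noteq> b'" "p \<noteq> c'" "p \<noteq> d'" for p
    using assms(2) that by (auto simp: proper_tangle_iff T cT_def split: if_splits)
  have par: "2 * m \<noteq> Suc (2 * n)" "Suc (2 * n) \<noteq> 2 * m" for m n :: nat
    by presburger+
  have all: "\<forall>p. P p" if "\<And>k. P (2 * k)" "\<And>k. P (Suc (2 * k))" for P :: "nat \<Rightarrow> bool"
    using that by (metis oddE evenE Suc_eq_plus1)
  note counts = count_ends_add_arcs count_ends_union ends_rename count_even count_odd [simplified]
  show "proper_tangle (beside S T)"
    unfolding proper_tangle_iff beside_def Let_def
    using dS dT nS nT iS iT
    by (intro conjI all) (auto simp add: counts S T par simp flip: cS_def cT_def)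
  show "proper_tangle (atop S T)"
    unfolding proper_tangle_iff atop_def Let_def
    using dS dT nS nT iS iT
    by (intro conjI all) (auto simp add: counts S T par simp flip: cS_def cT_def)
qed

lemma proper_tangle_twist_link_blocks: "proper_tangle (twist_link_blocks n)"
proof (induction n)
  case 0
  show ?case
    by (auto simp: proper_tangle_def horizontal_strands_def points_def ends_def)
next
  case (Suc n)
  have "proper_tangle twist_block"
    by (auto simp: proper_tangle_def twist_block_def points_def ends_def)
  with Suc show ?case
    by (simp add: proper_tangle_glue twist_link_block_def Hopf_block_def)
qed

lemma closed_diagram_twist_link: "closed_diagram (twist_link n)"
  using proper_tangle_twist_link_blocks [of n]
  unfolding proper_tangle_iff closed_diagram_iff twist_link_def Let_def
  by (auto simp: count_ends_add_arcs split: if_splits)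

lemma closed_diagram_twist_bracelet: "closed_diagram (twist_bracelet n)"
  using proper_tangle_twist_link_blocks [of n]
  unfolding proper_tangle_iff closed_diagram_iff twist_bracelet_def Let_def
  by (auto simp: count_ends_add_arcs split: if_splits)

lemma closed_diagram_state:
  assumes "closed_diagram D" "s \<in> split_choices D"
  shows "closed_diagram (state D s)"
proof -
  have *: "count_list (concat (map (\<lambda>(p, q). [p, q]) (concat (map2 split_crossing s cs)))) p =
      count_list (concat (map (\<lambda>(a, b, c, d). [a, b, c, d]) cs)) p"
    if "length s = length cs" for s cs p
    using that
  proof (induction s cs rule: list_induct2)
    case (Cons x xs y ys)
    then show ?case
      by (cases y; cases x) (auto simp: count_list_append')
  qed simp
  have "count_list (ends (state D s)) p = count_list (ends D) p" for p
    using assms(2) by (simp add: ends_def state_def split_choices_def count_list_append' *)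
  with assms(1) show ?thesis
    by (simp add: closed_diagram_iff)
qed

end

theory Submission
  imports Defs
begin

text \<open>
  The proof is a transfer computation in the style of the Kauffman bracket. Splitting all crossings
  of a tangle leaves some closed circles and two strands that join the four corners in pairs. In the
  tangles at hand the strands are either horizontal (NW--NE, SW--SE) or vertical (NW--SW, NE--SE).
  So all that a closure can see of a tangle is a pair of polynomials \<open>p\<close>, \<open>q\<close>, which count its
  horizontal and its vertical states by their numbers of closed circles; this is the relation
  \<open>expands T p q\<close>.
  
  Placing tangles side by side multiplies these expansions: two horizontal states give a
  horizontal one, every other combination a vertical one, and two vertical states in addition close
  up a new circle between them (\<open>expands_beside\<close>). Stacking and the closure to a link are obtained from
  the side by side composition and the closure to a bracelet by exchanging the corners NE and SW,
  which exchanges \<open>p\<close> and \<open>q\<close>. A crossing expands to \<open>(1, 1)\<close>, hence a Hopf block to \<open>(x + 2, 1)\<close>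
  and a twist-link block to \<open>(x + 2, 2x + 3)\<close>. One more block therefore turns \<open>(p, q)\<close> into
  \<open>((x + 2) p, (2x + 3) p + (2x\<^sup>2 + 4x + 2) q)\<close>.
  
  The bracelet has the polynomial \<open>x\<^sup>2 p + x q\<close> and the link \<open>x p + x\<^sup>2 q\<close>, which gives the
  recurrence. The transfer matrix is triangular with eigenvalues \<open>x + 2\<close> and
  \<open>2x\<^sup>2 + 4x + 2 = (x + 2) + x (2x + 3)\<close>, so that \<open>p = (x + 2)^n\<close> and
  \<open>x q = (2x\<^sup>2 + 4x + 2)^n - (x + 2)^n\<close>, which gives the closed form.
  
  The circles of a state are the components of its graph of arcs, so gluing tangles only requires to
  know how components and connectedness change under disjoint unions and under the insertion of a
  single arc (\<open>components_Un\<close>, \<open>components_insert\<close>, \<open>linked_insert\<close>).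
\<close>

section \<open>Components of a finite set of arcs\<close>

definition linked :: "('a \<times> 'a) set \<Rightarrow> ('a \<times> 'a) set" where
  "linked E = (E \<union> E\<inverse>)\<^sup>*"

definition components :: "('a \<times> 'a) set \<Rightarrow> nat" where
  "components E = card (Field E // linked E)"

lemma linked_refl [simp]: "(x, x) \<in> linked E"
  by (simp add: linked_def)

lemma linked_sym: "(x, y) \<in> linked E \<Longrightarrow> (y, x) \<in> linked E"
  unfolding linked_def by (metis sym_Un_converse sym_rtrancl symD)

lemma linked_trans: "(x, y) \<in> linked E \<Longrightarrow> (y, z) \<in> linked E \<Longrightarrow> (x, z) \<in> linked E"
  unfolding linked_def by simp

lemma linked_commute: "(x, y) \<in> linked E \<longleftrightarrow> (y, x) \<in> linked E"
  by (blast intro: linked_sym)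

lemma linked_arc: "(x, y) \<in> E \<Longrightarrow> (x, y) \<in> linked E"
  unfolding linked_def by blast

lemma linked_mono: "E \<subseteq> F \<Longrightarrow> linked E \<subseteq> linked F"
  unfolding linked_def by (intro rtrancl_mono) blast

lemma equiv_linked: "equiv UNIV (linked E)"
  by (intro equivI refl_onI symI transI) (auto intro: linked_sym linked_trans)

lemma linked_empty [simp]: "linked {} = Id"
  by (simp add: linked_def)

lemma linked_Field: "(x, y) \<in> linked E \<Longrightarrow> x \<in> Field E \<longleftrightarrow> y \<in> Field E"
  unfolding linked_def by (induction rule: rtrancl_induct) (auto simp: Field_def)

lemma linked_insert:
  "(x, y) \<in> linked (insert (a, b) E) \<longleftrightarrow>
     (x, y) \<in> linked E \<or> (x, a) \<in> linked E \<and> (b, y) \<in> linked E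
       \<or> (x, b) \<in> linked E \<and> (a, y) \<in> linked E"
  (is "?L \<longleftrightarrow> ?R")
proof
  assume ?L
  then show ?R
    unfolding linked_def [of "insert (a, b) E"]
  proof (induction rule: rtrancl_induct)
    case (step y z)
    from step.hyps(2) have "y = a \<and> z = b \<or> y = b \<and> z = a \<or> (y, z) \<in> linked E"
      by (auto intro: linked_arc linked_sym)
    with step.IH show ?case
      by (metis linked_refl linked_sym linked_trans)
  qed simp
next
  have "linked E \<subseteq> linked (insert (a, b) E)" "(a, b) \<in> linked (insert (a, b) E)"
    by (auto intro!: linked_mono linked_arc)
  moreover assume ?R
  ultimately show ?L
    by (meson linked_sym linked_trans subsetD)
qed

text \<open>
  A new arc between existing points fuses the components of its two ends, unless these agree
  already. The equation is solved for the old number of components to avoid truncated subtraction.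
\<close>

lemma components_insert:
  assumes "finite E" "a \<in> Field E" "b \<in> Field E"
  shows "components E =
    (if (a, b) \<in> linked E then components (insert (a, b) E) else Suc (components (insert (a, b) E)))"
proof -
  have Field: "Field (insert (a, b) E) = Field E"
    using assms by (auto simp: Field_def)
  show ?thesis
  proof (cases "(a, b) \<in> linked E")
    case True
    then have "linked (insert (a, b) E) = linked E"
      by (auto simp: linked_insert) (meson linked_sym linked_trans)+
    with True Field show ?thesis
      by (simp add: components_def)
  next
    case False
    define A where "A = linked E `` {a}"
    define B where "B = linked E `` {b}"
    \<comment> \<open>\<open>Q\<close> collects the components that the new arc leaves untouched.\<close>
    define Q where "Q = Field E // linked E - {A, B}"
    have old: "Field E // linked E = insert A (insert B Q)"
      using assms by (auto simp: Q_def A_def B_def quotientI)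
    have class_new: "linked (insert (a, b) E) `` {x} =
        (if x \<in> A \<union> B then A \<union> B else linked E `` {x})" for x
      by (rule set_eqI, simp add: A_def B_def linked_insert)
         (meson linked_refl linked_sym linked_trans)
    have cls: "linked E `` {x} = A \<longleftrightarrow> x \<in> A" "linked E `` {x} = B \<longleftrightarrow> x \<in> B" for x
      unfolding A_def B_def using equiv_class_eq_iff [OF equiv_linked]
      by (metis Image_singleton_iff UNIV_I)+
    have new: "Field E // linked (insert (a, b) E) = insert (A \<union> B) Q"
    proof -
      have "a \<in> A" by (simp add: A_def)
      then have "A \<union> B \<in> Field E // linked (insert (a, b) E)"
        using assms(2) class_new [of a] by (auto simp: quotient_def)
      moreover have "X \<in> Field E // linked (insert (a, b) E)" if "X \<in> Q" for X
      proof -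
        from that obtain x where "x \<in> Field E" "X = linked E `` {x}" "x \<notin> A \<union> B"
          unfolding Q_def using cls by (auto elim!: quotientE)
        with class_new [of x] show ?thesis
          by (metis quotientI)
      qed
      moreover have "X \<in> insert (A \<union> B) Q" if "X \<in> Field E // linked (insert (a, b) E)" for X
      proof -
        from that obtain x where "x \<in> Field E" "X = linked (insert (a, b) E) `` {x}"
          by (auto elim!: quotientE)
        with class_new [of x] cls [of x] show ?thesis
          by (auto simp: Q_def quotientI)
      qed
      ultimately show ?thesis by blast
    qed
    have "finite (Field E)"
      using assms(1) by (rule finite_Field)
    then have fin: "finite Q"
      unfolding Q_def quotient_def by simp
    have "A \<noteq> B" "A \<notin> Q" "B \<notin> Q"
      using False cls(2) [of a] by (auto simp: Q_def A_def B_def linked_commute)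
    moreover have "A \<union> B \<notin> Q"
    proof
      assume "A \<union> B \<in> Q"
      then obtain x where x: "A \<union> B = linked E `` {x}" "A \<union> B \<noteq> A"
        unfolding Q_def by (metis DiffE insertCI quotientE)
      have "a \<in> A \<union> B"
        by (simp add: A_def)
      then have "x \<in> A"
        unfolding x(1) by (simp add: A_def linked_commute)
      with x(1) have "A \<union> B = A"
        by (simp add: cls)
      with x(2) show False ..
    qed
    ultimately show ?thesis
      using False fin unfolding components_def Field old new by simp
  qed
qed

text \<open>
  A path that starts at a point of \<open>E\<close> can never change over to \<open>F\<close>.
\<close>

lemma linked_Un_left:
  assumes "Field E \<inter> Field F = {}" "x \<in> Field E"
  shows "(x, y) \<in> linked (E \<union> F) \<longleftrightarrow> (x, y) \<in> linked E"
proof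
  assume "(x, y) \<in> linked (E \<union> F)"
  then show "(x, y) \<in> linked E"
    unfolding linked_def [of "E \<union> F"]
  proof (induction rule: rtrancl_induct)
    case (step y z)
    then have "y \<in> Field E"
      using assms linked_Field by metis
    with step.hyps(2) assms(1) have "(y, z) \<in> E \<union> E\<inverse>"
      by (auto simp: Field_def)
    then have "(y, z) \<in> linked E"
      by (auto intro: linked_arc linked_sym)
    with step.IH show ?case
      by (rule linked_trans)
  qed simp
qed (use linked_mono [of E "E \<union> F"] in blast)

lemma linked_Un_right:
  assumes "Field E \<inter> Field F = {}" "x \<in> Field F"
  shows "(x, y) \<in> linked (E \<union> F) \<longleftrightarrow> (x, y) \<in> linked F"
  using linked_Un_left [of F E x y] assms by (simp add: Un_commute Int_commute)

lemma components_Un: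
  assumes "finite E" "finite F" "Field E \<inter> Field F = {}"
  shows "components (E \<union> F) = components E + components F"
proof -
  have "Field (E \<union> F) // linked (E \<union> F) = Field E // linked E \<union> Field F // linked F"
    using assms(3) unfolding quotient_def Field_Un
    by (auto simp: linked_Un_left linked_Un_right Image_singleton)
  moreover have "(Field E // linked E) \<inter> (Field F // linked F) = {}"
  proof -
    have "x \<in> Field F" if "x \<in> Field E" "y \<in> Field F" "linked E `` {x} = linked F `` {y}" for x y
      using that linked_Field by (metis Image_singleton_iff linked_refl)
    then show ?thesis
      using assms(3) unfolding quotient_def by auto
  qed
  moreover have "finite (Field E // linked E)" "finite (Field F // linked F)"
    using assms by (simp_all add: quotient_def finite_Field)
  ultimately show ?thesis
    by (simp add: components_def card_Un_disjoint)
qed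

lemma Field_image: "Field (map_prod f f ` E) = f ` Field E"
  by (force simp: Field_def)

lemma linked_image:
  assumes "inj f"
  shows "(f x, f y) \<in> linked (map_prod f f ` E) \<longleftrightarrow> (x, y) \<in> linked E"
proof
  have "\<exists>y'. z = f y' \<and> (x, y') \<in> linked E" if "(f x, z) \<in> linked (map_prod f f ` E)" for z
    using that unfolding linked_def [of "map_prod f f ` E"]
  proof (induction rule: rtrancl_induct)
    case (step y z)
    then obtain u where u: "y = f u" "(x, u) \<in> linked E" by blast
    from step.hyps(2) u(1) obtain v where "z = f v" "(u, v) \<in> E \<union> E\<inverse>"
      using assms by (auto dest: injD)
    moreover from this have "(u, v) \<in> linked E"
      by (auto intro: linked_sym linked_arc)
    ultimately show ?case
      using u by (blast intro: linked_trans)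
  qed auto
  then show "(f x, f y) \<in> linked (map_prod f f ` E) \<Longrightarrow> (x, y) \<in> linked E"
    using assms by (auto dest: injD)
next
  assume "(x, y) \<in> linked E"
  then show "(f x, f y) \<in> linked (map_prod f f ` E)"
    unfolding linked_def [of E]
  proof (induction rule: rtrancl_induct)
    case (step y z)
    then have "(f y, f z) \<in> linked (map_prod f f ` E)"
      by (force intro: linked_sym linked_arc)
    with step.IH show ?case
      by (rule linked_trans)
  qed simp
qed

lemma components_image:
  assumes "inj f"
  shows "components (map_prod f f ` E) = components E"
proof -
  let ?F = "map_prod f f ` E"
  have "linked ?F `` {f x} = f ` (linked E `` {x})" if "x \<in> Field E" for x
  proof -
    have "z \<in> f ` (linked E `` {x})" if z: "(f x, z) \<in> linked ?F" for z
    proof -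
      obtain y where "z = f y"
        using linked_Field [OF z] \<open>x \<in> Field E\<close> by (auto simp: Field_image)
      with z show ?thesis
        by (simp add: linked_image [OF assms])
    qed
    moreover have "f y \<in> linked ?F `` {f x}" if "(x, y) \<in> linked E" for y
      using that by (simp add: linked_image [OF assms])
    ultimately show ?thesis
      by blast
  qed
  then have "Field ?F // linked ?F = image f ` (Field E // linked E)"
    unfolding quotient_def Field_image by auto
  moreover have "inj_on (image f) (Field E // linked E)"
    using assms by (meson inj_image_eq_iff inj_onI)
  ultimately show ?thesis
    by (simp add: components_def card_image)
qed

lemma components_single: "components {(a, b)} = 1"
proof -
  have "Field {(a, b)} // linked {(a, b)} = {{a, b}}"
    by (auto simp: quotient_def Field_def linked_insert)
  then show ?thesis
    by (simp add: components_def)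
qed

section \<open>States as sets of arcs\<close>

definition state_arcs :: "diagram \<Rightarrow> split list \<Rightarrow> (nat \<times> nat) set" where
  "state_arcs D s = set (arcs (state D s))"

lemma finite_state_arcs [simp]: "finite (state_arcs D s)"
  by (simp add: state_arcs_def)

lemma state_arcs_eq:
  "state_arcs D s = set (arcs D) \<union> (\<Union>(\<sigma>, c) \<in> set (zip s (crossings D)). set (split_crossing \<sigma> c))"
  by (auto simp: state_arcs_def state_def)

text \<open>
  Without crossings every marked point is an end of an arc, so the vertex set of the graph can be
  read off from the set of arcs. The gluing arguments need only this set, which is insensitive to the
  order in which \<open>state\<close> lists the arcs.
\<close>

lemma circles_eq_components:
  assumes "crossings S = []"
  shows "circles S = components (set (arcs S))"
proof -
  let ?E = "set (arcs S)"
  have points: "points S = Field ?E"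
    by (force simp: points_def ends_def assms Field_def)
  have "connected_points S `` {x} = linked ?E `` {x}" if "x \<in> Field ?E" for x
    using that linked_Field [of x _ ?E] by (auto simp: connected_points_def points linked_def)
  then have "points S // connected_points S = Field ?E // linked ?E"
    by (simp add: quotient_def points)
  then show ?thesis
    by (simp add: circles_def components_def)
qed

lemma generating_poly_components:
  "generating_poly D = (\<Sum>s \<in> split_choices D. monom 1 (components (state_arcs D s)))"
  by (simp add: generating_poly_def circles_eq_components state_arcs_def state_def)

lemma state_arcs_add_arcs: "state_arcs (add_arcs as D) s = set as \<union> state_arcs D s"
  by (auto simp: state_arcs_eq add_arcs_def)

lemma state_arcs_union:
  assumes "length s = length (crossings D)"
  shows "state_arcs (union_diagram D E) (s @ t) = state_arcs D s \<union> state_arcs E t"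
  using assms by (auto simp: state_arcs_eq union_diagram_def)

text \<open>
  Renaming and splitting commute, because a split sees only the positions of the four ends.
\<close>

lemma state_arcs_rename: "state_arcs (body (rename f T)) s = map_prod f f ` state_arcs (body T) s"
proof -
  have "set (split_crossing \<sigma> (f a, f b, f c, f d)) = map_prod f f ` set (split_crossing \<sigma> (a, b, c, d))"
    for \<sigma> a b c d by (cases \<sigma>) auto
  then show ?thesis
    unfolding state_arcs_eq rename_def
    by (simp add: zip_map2 image_Un image_UN case_prod_unfold map_prod_def)
qed

lemma split_choices_beside:
  "split_choices (body (beside S T)) =
     {u. length u = length (crossings (body S)) + length (crossings (body T))}"
  by (simp add: split_choices_def beside_def Let_def add_arcs_def union_diagram_def rename_def)

lemma split_choices_add_arcs [simp]: "split_choices (add_arcs as D) = split_choices D"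
  by (simp add: split_choices_def add_arcs_def)

lemma sum_lists_append:
  "(\<Sum>u \<in> {u :: 'a::finite list. length u = m + n}. f u) =
     (\<Sum>s \<in> {s. length s = m}. \<Sum>t \<in> {t. length t = n}. f (s @ t))"
proof -
  have "finite {s :: 'a list. length s = m}" for m
    using finite_lists_length_eq [of "UNIV :: 'a set" m] by simp
  then show ?thesis
    by (subst sum.cartesian_product)
       (rule sum.reindex_bij_witness [of _ "\<lambda>(s, t). s @ t" "\<lambda>u. (take m u, drop m u)"]; auto)
qed

instance split :: finite
proof
  have "(UNIV :: split set) = {Split0, Split1}"
    using split.exhaust by blast
  then show "finite (UNIV :: split set)"
    by (metis finite.emptyI finite.insertI)
qed

section \<open>Expansion of a tangle\<close>

text \<open>
  \<open>E\<close> is the set of arcs of a crossingless tangle with the given corners; the Boolean tells whether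
  its two strands are horizontal or vertical, and \<open>k\<close> is the number of its closed circles. The two
  remaining components are the strands.
\<close>

definition resolves ::
  "('a \<times> 'a) set \<Rightarrow> 'a \<Rightarrow> 'a \<Rightarrow> 'a \<Rightarrow> 'a \<Rightarrow> bool \<Rightarrow> nat \<Rightarrow> bool" where
  "resolves E nw ne sw se h k \<longleftrightarrow>
     finite E \<and> {nw, ne, sw, se} \<subseteq> Field E \<and> components E = k + 2 \<and>
     (if h then (nw, ne) \<in> linked E \<and> (sw, se) \<in> linked E \<and> (nw, sw) \<notin> linked E
      else (nw, sw) \<in> linked E \<and> (ne, se) \<in> linked E \<and> (nw, ne) \<notin> linked E)"

text \<open>
  Exchanging the corners NE and SW is the reflection in the diagonal from NW to SE.
\<close>

lemma resolves_transpose: "resolves E nw sw ne se (\<not> h) k \<longleftrightarrow> resolves E nw ne sw se h k"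
  by (auto simp: resolves_def)

lemma resolves_image:
  assumes "inj f" "resolves E a b c d h k"
  shows "resolves (map_prod f f ` E) (f a) (f b) (f c) (f d) h k"
  using assms by (auto simp: resolves_def linked_image components_image Field_image)

lemma resolves_linked:
  assumes "resolves E a b c d h k"
  shows "(a, b) \<in> linked E \<longleftrightarrow> h" "(c, d) \<in> linked E \<longleftrightarrow> h"
    "(a, c) \<in> linked E \<longleftrightarrow> \<not> h" "(b, d) \<in> linked E \<longleftrightarrow> \<not> h"
    "(a, d) \<notin> linked E" "(b, c) \<notin> linked E"
    "(b, a) \<in> linked E \<longleftrightarrow> h" "(d, c) \<in> linked E \<longleftrightarrow> h"
    "(c, a) \<in> linked E \<longleftrightarrow> \<not> h" "(d, b) \<in> linked E \<longleftrightarrow> \<not> h"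
    "(d, a) \<notin> linked E" "(c, b) \<notin> linked E"
  using assms unfolding resolves_def by (metis linked_sym linked_trans)+

text \<open>
  The disjoint union has \<open>k + k' + 4\<close> components. The lower joining arc always fuses a component of
  \<open>E\<close> with one of \<open>F\<close>. The upper one fuses two further components, except when both parts are
  vertical: then the right strand of \<open>E\<close> and the left strand of \<open>F\<close> have become one component
  already, and the upper arc closes it to a circle.
\<close>

lemma resolves_beside:
  assumes E: "resolves E a b c d h k" and F: "resolves F a' b' c' d' h' k'"
    and disj: "Field E \<inter> Field F = {}"
  shows "resolves (insert (b, a') (insert (d, c') (E \<union> F))) a b' c d' (h \<and> h')
    (k + k' + (if h \<or> h' then 0 else 1))"
proof -
  have mem: "a \<in> Field E" "b \<in> Field E" "c \<in> Field E" "d \<in> Field E"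
    "a' \<in> Field F" "b' \<in> Field F" "c' \<in> Field F" "d' \<in> Field F"
    using E F by (auto simp: resolves_def)
  have fin: "finite E" "finite F"
    using E F by (auto simp: resolves_def)
  have cross: "(x, y) \<notin> linked E" "(y, x) \<notin> linked F" "(y, x) \<notin> linked E" "(x, y) \<notin> linked F"
    if "x \<in> Field E" "y \<in> Field F" for x y
    using that disj linked_Field by (metis disjoint_iff)+
  note links = linked_Un_left [OF disj] linked_Un_right [OF disj] cross mem
    resolves_linked [OF E] resolves_linked [OF F]
  let ?G = "insert (d, c') (E \<union> F)"
  have "components (E \<union> F) = k + k' + 4"
    using components_Un [OF fin disj] E F by (simp add: resolves_def)
  moreover have "components (E \<union> F) = Suc (components ?G)"
    using components_insert [of "E \<union> F" d c'] fin by (simp add: links Field_Un)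
  moreover have "(b, a') \<in> linked ?G \<longleftrightarrow> \<not> (h \<or> h')"
    by (simp add: linked_insert links)
  then have "components ?G = (if h \<or> h' then 1 else 0) + components (insert (b, a') ?G)"
    using components_insert [of ?G b a'] fin mem by (simp add: Field_Un)
  ultimately have "components (insert (b, a') ?G) = k + k' + (if h \<or> h' then 0 else 1) + 2"
    by (simp split: if_split_asm)
  moreover have "{a, b', c, d'} \<subseteq> Field (insert (b, a') ?G)"
    using mem by (simp add: Field_insert)
  ultimately show ?thesis
    using fin by (cases h; cases h') (simp_all add: resolves_def linked_insert links)
qed

text \<open>
  In terms of the skein module of the disc with four ends this says \<open>T = p H + q V\<close>, where \<open>H\<close> and \<open>V\<close>
  are the two crossingless tangles without circles and a circle counts as the variable \<open>x\<close>. In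
  particular every state is required to be of one of these two types; the third pairing
  NW--SE, SW--NE, which a nonplanar encoding could produce, is excluded.
\<close>

definition expands :: "tangle \<Rightarrow> int poly \<Rightarrow> int poly \<Rightarrow> bool" where
  "expands T p q \<longleftrightarrow> (\<exists>h k.
     (\<forall>s \<in> split_choices (body T).
        resolves (state_arcs (body T) s) (NW T) (NE T) (SW T) (SE T) (h s) (k s)) \<and>
     p = (\<Sum>s \<in> split_choices (body T). if h s then monom 1 (k s) else 0) \<and>
     q = (\<Sum>s \<in> split_choices (body T). if h s then 0 else monom 1 (k s)))"

lemma state_arcs_beside:
  assumes "length s = length (crossings (body S))"
  shows "state_arcs (body (beside S T)) (s @ t) =
    insert (2 * NE S, 2 * NW T + 1) (insert (2 * SE S, 2 * SW T + 1)
      (map_prod (\<lambda>p. 2 * p) (\<lambda>p. 2 * p) ` state_arcs (body S) s \<union>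
       map_prod (\<lambda>p. 2 * p + 1) (\<lambda>p. 2 * p + 1) ` state_arcs (body T) t))"
proof -
  have "length s = length (crossings (body (rename (\<lambda>p. 2 * p) S)))"
    using assms by (simp add: rename_def)
  then show ?thesis
    by (simp add: beside_def Let_def state_arcs_add_arcs state_arcs_union state_arcs_rename)
qed

text \<open>
  This is the product \<open>(p H + q V) (p' H + q' V)\<close> for the rules \<open>H H = H\<close>, \<open>H V = V H = V\<close> and
  \<open>V V = x V\<close>: the choices of splits for the composite are the concatenations of choices for the parts,
  so that the state sums multiply.
\<close>

lemma expands_beside:
  assumes "expands S p q" "expands T p' q'"
  shows "expands (beside S T) (p * p') (p * q' + q * p' + [:0, 1:] * q * q')"
proof -
  define m where "m = length (crossings (body S))"
  define n where "n = length (crossings (body T))"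
  obtain h k where S: "\<And>s. length s = m \<Longrightarrow>
        resolves (state_arcs (body S) s) (NW S) (NE S) (SW S) (SE S) (h s) (k s)"
    and p: "p = (\<Sum>s \<in> {s. length s = m}. if h s then monom 1 (k s) else 0)"
    and q: "q = (\<Sum>s \<in> {s. length s = m}. if h s then 0 else monom 1 (k s))"
    using assms(1) by (auto simp: expands_def split_choices_def m_def)
  obtain h' k' where T: "\<And>t. length t = n \<Longrightarrow>
        resolves (state_arcs (body T) t) (NW T) (NE T) (SW T) (SE T) (h' t) (k' t)"
    and p': "p' = (\<Sum>t \<in> {t. length t = n}. if h' t then monom 1 (k' t) else 0)"
    and q': "q' = (\<Sum>t \<in> {t. length t = n}. if h' t then 0 else monom 1 (k' t))"
    using assms(2) by (auto simp: expands_def split_choices_def n_def)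
  \<comment> \<open>A list of splits for the composite falls into its first \<open>m\<close> and its last \<open>n\<close> entries.\<close>
  define H where "H u \<longleftrightarrow> h (take m u) \<and> h' (drop m u)" for u
  define K where "K u = k (take m u) + k' (drop m u) +
    (if h (take m u) \<or> h' (drop m u) then 0 else 1)" for u
  have choices: "split_choices (body (beside S T)) = {u. length u = m + n}"
    by (simp add: split_choices_beside m_def n_def)
  have corners: "NW (beside S T) = 2 * NW S" "NE (beside S T) = 2 * NE T + 1"
    "SW (beside S T) = 2 * SW S" "SE (beside S T) = 2 * SE T + 1"
    by (simp_all add: beside_def Let_def)
  have parity: "2 * x \<noteq> 2 * y + 1" for x y :: nat
    by presburger
  have "resolves (state_arcs (body (beside S T)) (s @ t)) (2 * NW S) (2 * NE T + 1)
      (2 * SW S) (2 * SE T + 1) (H (s @ t)) (K (s @ t))"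
    if "length s = m" "length t = n" for s t
  proof -
    let ?E = "map_prod (\<lambda>p. 2 * p) (\<lambda>p. 2 * p) ` state_arcs (body S) s"
    let ?F = "map_prod (\<lambda>p. 2 * p + 1) (\<lambda>p. 2 * p + 1) ` state_arcs (body T) t"
    have "Field ?E \<inter> Field ?F = {}"
      unfolding Field_image using parity by auto
    moreover have "inj (\<lambda>p :: nat. 2 * p)" "inj (\<lambda>p :: nat. 2 * p + 1)"
      by (simp_all add: inj_def)
    ultimately have "resolves (insert (2 * NE S, 2 * NW T + 1) (insert (2 * SE S, 2 * SW T + 1)
      (?E \<union> ?F))) (2 * NW S) (2 * NE T + 1) (2 * SW S) (2 * SE T + 1) (h s \<and> h' t)
      (k s + k' t + (if h s \<or> h' t then 0 else 1))"
      using S [OF that(1)] T [OF that(2)] by (intro resolves_beside resolves_image)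
    then show ?thesis
      using that state_arcs_beside [of s S T t] by (simp add: H_def K_def m_def)
  qed
  from this [of "take m u" "drop m u" for u] have "resolves (state_arcs (body (beside S T)) u)
      (2 * NW S) (2 * NE T + 1) (2 * SW S) (2 * SE T + 1) (H u) (K u)" if "length u = m + n" for u
    using that by simp
  moreover have "p * p' = (\<Sum>u \<in> {u. length u = m + n}. if H u then monom 1 (K u) else 0)"
    unfolding p p' sum_product sum_lists_append
    by (intro sum.cong) (auto simp: H_def K_def mult_monom)
  moreover have "p * q' + q * p' + [:0, 1:] * q * q' =
      (\<Sum>u \<in> {u. length u = m + n}. if H u then 0 else monom 1 (K u))"
    unfolding p p' q q' mult.assoc unfolding sum_product unfolding sum_distrib_left
    unfolding sum_lists_append sum.distrib [symmetric]
    by (intro sum.cong) (auto simp: H_def K_def mult_monom monom_Suc)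
  ultimately show ?thesis
    unfolding expands_def choices corners by blast
qed

definition transpose_tangle :: "tangle \<Rightarrow> tangle" where
  "transpose_tangle T = Tangle (body T) (NW T) (SW T) (NE T) (SE T)"

lemma expands_transpose:
  assumes "expands T p q"
  shows "expands (transpose_tangle T) q p"
proof -
  obtain h k where *: "\<forall>s \<in> split_choices (body T).
        resolves (state_arcs (body T) s) (NW T) (NE T) (SW T) (SE T) (h s) (k s)"
      "p = (\<Sum>s \<in> split_choices (body T). if h s then monom 1 (k s) else 0)"
      "q = (\<Sum>s \<in> split_choices (body T). if h s then 0 else monom 1 (k s))"
    using assms unfolding expands_def by blast
  show ?thesis
    unfolding expands_def
    by (rule exI [of _ "\<lambda>s. \<not> h s"], rule exI [of _ k])
       (use * in \<open>auto simp: transpose_tangle_def resolves_transpose intro!: sum.cong\<close>)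
qed

text \<open>
  The reflection turns stacking into placing side by side, so that the rule for stacking need not be
  derived separately.
\<close>

lemma atop_eq_transpose_beside:
  "atop S T = transpose_tangle (beside (transpose_tangle S) (transpose_tangle T))"
  by (simp add: atop_def beside_def transpose_tangle_def rename_def Let_def)

lemma expands_atop:
  assumes "expands S p q" "expands T p' q'"
  shows "expands (atop S T) (q * p' + p * q' + [:0, 1:] * p * p') (q * q')"
  unfolding atop_eq_transpose_beside
  by (intro expands_transpose expands_beside assms)

section \<open>Closures\<close>

text \<open>
  A horizontal pair of strands is closed to two circles. A vertical one is closed to a single circle:
  the lower closing arc connects the two strands, and the upper one closes the result.
\<close>

lemma generating_poly_closure:
  assumes "expands T p q"
  shows "generating_poly (add_arcs [(NW T, NE T), (SW T, SE T)] (body T)) =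
    [:0, 1:]\<^sup>2 * p + [:0, 1:] * q"
proof -
  obtain h k where res: "\<And>s. s \<in> split_choices (body T) \<Longrightarrow>
        resolves (state_arcs (body T) s) (NW T) (NE T) (SW T) (SE T) (h s) (k s)"
      and p: "p = (\<Sum>s \<in> split_choices (body T). if h s then monom 1 (k s) else 0)"
      and q: "q = (\<Sum>s \<in> split_choices (body T). if h s then 0 else monom 1 (k s))"
    using assms unfolding expands_def by blast
  have "monom 1 (components (state_arcs (add_arcs [(NW T, NE T), (SW T, SE T)] (body T)) s)) =
      [:0, 1:]\<^sup>2 * (if h s then monom 1 (k s) else 0) +
      [:0, 1:] * (if h s then 0 else monom 1 (k s) :: int poly)"
    if "s \<in> split_choices (body T)" for s
  proof -
    let ?E = "state_arcs (body T) s"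
    let ?E' = "insert (SW T, SE T) ?E"
    note res = res [OF that]
    note links = resolves_linked [OF res]
    have mem: "{NW T, NE T, SW T, SE T} \<subseteq> Field ?E" and k: "components ?E = k s + 2"
      using res by (auto simp: resolves_def)
    have "components ?E = (if h s then components ?E' else Suc (components ?E'))"
      using components_insert [of ?E "SW T" "SE T"] mem by (simp add: links)
    moreover have "(NW T, NE T) \<in> linked ?E'"
      using links by (auto simp: linked_insert linked_commute)
    then have "components ?E' = components (insert (NW T, NE T) ?E')"
      using components_insert [of ?E' "NW T" "NE T"] mem by (auto simp: Field_def)
    ultimately have "components (insert (NW T, NE T) ?E') = (if h s then k s + 2 else k s + 1)"
      using k by (auto split: if_splits)
    then show ?thesis
      by (simp add: state_arcs_add_arcs monom_Suc power2_eq_square)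
  qed
  then show ?thesis
    by (simp add: generating_poly_components p q sum_distrib_left sum.distrib)
qed

lemma generating_poly_twist_bracelet:
  assumes "expands (twist_link_blocks n) p q"
  shows "generating_poly (twist_bracelet n) = [:0, 1:]\<^sup>2 * p + [:0, 1:] * q"
  using generating_poly_closure [OF assms] by (simp add: twist_bracelet_def Let_def)

text \<open>
  Joining NW to SW and NE to SE is the closure to a bracelet of the reflected tangle.
\<close>

lemma generating_poly_twist_link:
  assumes "expands (twist_link_blocks n) p q"
  shows "generating_poly (twist_link n) = [:0, 1:] * p + [:0, 1:]\<^sup>2 * q"
  using generating_poly_closure [OF expands_transpose [OF assms]]
  by (simp add: twist_link_def transpose_tangle_def Let_def)

section \<open>The blocks\<close>

lemma components_disjoint_arcs:
  assumes "{a, b} \<inter> {c, d} = {}"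
  shows "components {(a, b), (c, d)} = 2"
  using components_Un [of "{(a, b)}" "{(c, d)}"] assms
  by (simp add: components_single Field_def insert_commute)

lemma expands_horizontal_strands: "expands horizontal_strands 1 0"
proof -
  have choices: "split_choices (body horizontal_strands) = {[]}"
    by (auto simp: split_choices_def horizontal_strands_def)
  show ?thesis
    unfolding expands_def choices
    by (rule exI [of _ "\<lambda>_. True"], rule exI [of _ "\<lambda>_. 0"])
       (auto simp: horizontal_strands_def resolves_def state_arcs_eq Field_def linked_insert
          components_disjoint_arcs)
qed

text \<open>
  With the ends listed as NW, NE, SE, SW, the split of type 0 joins NW to NE and SE to SW, hence is
  the horizontal one.
\<close>

lemma expands_twist_block: "expands twist_block 1 1"
proof -
  have choices: "split_choices (body twist_block) = {[Split0], [Split1]}"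
  proof -
    have "s = Split0 \<or> s = Split1" for s
      by (cases s) auto
    then show ?thesis
      by (auto simp: split_choices_def twist_block_def length_Suc_conv)
  qed
  show ?thesis
    unfolding expands_def choices
    by (rule exI [of _ "\<lambda>s. s = [Split0]"], rule exI [of _ "\<lambda>_. 0"])
       (auto simp: twist_block_def resolves_def state_arcs_eq Field_def linked_insert
          components_disjoint_arcs)
qed

lemma expands_twist_link_block: "expands twist_link_block [:2, 1:] [:3, 2:]"
proof -
  have "expands Hopf_block [:2, 1:] 1"
    using expands_atop [OF expands_twist_block expands_twist_block]
    by (simp add: Hopf_block_def one_pCons)
  from expands_beside [OF this expands_twist_block] show ?thesis
    by (simp add: twist_link_block_def one_pCons)
qed

text \<open>
  The coefficient of \<open>q\<close> is \<open>(x + 2) + x (2x + 3)\<close>: a vertical state stays vertical, and gains a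
  circle for each vertical state of the new block.
\<close>

lemma expands_twist_link_blocks_Suc:
  assumes "expands (twist_link_blocks n) p q"
  shows "expands (twist_link_blocks (Suc n)) ([:2, 1:] * p) ([:3, 2:] * p + [:2, 4, 2:] * q)"
proof -
  have "p * [:3, 2:] + q * [:2, 1:] + [:0, 1:] * q * [:3, 2:] =
      p * [:3, 2:] + q * ([:2, 1:] + [:0, 1:] * [:3, 2:])"
    by (simp only: algebra_simps)
  also have "\<dots> = [:3, 2:] * p + [:2, 4, 2:] * q"
    by (simp add: mult.commute)
  finally have "p * [:3, 2:] + q * [:2, 1:] + [:0, 1:] * q * [:3, 2:] =
      [:3, 2:] * p + [:2, 4, 2:] * q" .
  from expands_beside [OF assms expands_twist_link_block, unfolded this] show ?thesis
    by (simp only: twist_link_blocks.simps mult.commute [of p])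
qed

text \<open>
  The closed form determines \<open>q\<close> only after multiplication by \<open>x\<close>; this is also the form in which \<open>q\<close>
  enters the polynomial of the bracelet, so that no division of polynomials is needed.
\<close>

lemma expands_twist_link_blocks:
  "\<exists>q. expands (twist_link_blocks n) ([:2, 1:] ^ n) q \<and>
       [:0, 1:] * q = [:2, 4, 2:] ^ n - [:2, 1:] ^ n"
proof (induction n)
  case 0
  then show ?case
    using expands_horizontal_strands by (intro exI [of _ 0]) simp
next
  case (Suc n)
  then obtain q where q: "expands (twist_link_blocks n) ([:2, 1:] ^ n) q"
      "[:0, 1:] * q = [:2, 4, 2:] ^ n - [:2, 1:] ^ n"
    by blast
  have "[:0, 1:] * ([:3, 2:] * [:2, 1:] ^ n + [:2, 4, 2:] * q) =
      ([:0, 1:] * [:3, 2:]) * [:2, 1:] ^ n + [:2, 4, 2:] * ([:0, 1:] * q)"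
    by (simp only: algebra_simps)
  \<comment> \<open>The product is the difference of the two eigenvalues, so that the sum telescopes.\<close>
  also have "[:0, 1:] * [:3, 2:] = [:2, 4, 2:] - ([:2, 1:] :: int poly)"
    by simp
  also have "([:2, 4, 2:] - [:2, 1:]) * [:2, 1:] ^ n + [:2, 4, 2:] * ([:0, 1:] * q) =
      [:2, 4, 2:] ^ Suc n - [:2, 1:] ^ Suc n"
    unfolding q(2) by (simp only: algebra_simps power_Suc)
  finally show ?case
    using expands_twist_link_blocks_Suc [OF q(1)] by (auto simp only: power_Suc)
qed

theorem theorem46:
  shows "(\<forall>n::nat. n \<ge> 1 \<longrightarrow>
            generating_poly (twist_bracelet n) =
              [:2, 1:] * generating_poly (twist_bracelet (n - 1))
              + [:3, 2:] * generating_poly (twist_link (n - 1)))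
       \<and> (\<forall>n::nat. generating_poly (twist_bracelet n) =
              [:2, 4, 2:] ^ n + [:-1, 0, 1:] * [:2, 1:] ^ n)"
proof (intro conjI allI impI)
  fix n :: nat
  assume "n \<ge> 1"
  then obtain m where n: "n = Suc m"
    by (cases n) auto
  obtain p q where pq: "expands (twist_link_blocks m) p q"
    using expands_twist_link_blocks by blast
  let ?x = "[:0, 1:] :: int poly"
  have "[:2, 4, 2:] = [:2, 1:] + ?x * [:3, 2:]"
    by simp
  then have "?x\<^sup>2 * ([:2, 1:] * p) + ?x * ([:3, 2:] * p + [:2, 4, 2:] * q) =
      [:2, 1:] * (?x\<^sup>2 * p + ?x * q) + [:3, 2:] * (?x * p + ?x\<^sup>2 * q)"
    by (simp only: algebra_simps power2_eq_square)
  then show "generating_poly (twist_bracelet n) =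
      [:2, 1:] * generating_poly (twist_bracelet (n - 1))
      + [:3, 2:] * generating_poly (twist_link (n - 1))"
    unfolding n diff_Suc_1 generating_poly_twist_link [OF pq] generating_poly_twist_bracelet [OF pq]
      generating_poly_twist_bracelet [OF expands_twist_link_blocks_Suc [OF pq]] .
next
  fix n :: nat
  obtain q where q: "expands (twist_link_blocks n) ([:2, 1:] ^ n) q"
      "[:0, 1:] * q = [:2, 4, 2:] ^ n - [:2, 1:] ^ n"
    using expands_twist_link_blocks by blast
  have *: "[:-1, 0, 1:] = [:0, 1:]\<^sup>2 - (1 :: int poly)"
    by (simp add: power2_eq_square one_pCons)
  show "generating_poly (twist_bracelet n) =
      [:2, 4, 2:] ^ n + [:-1, 0, 1:] * [:2, 1:] ^ n"
    unfolding generating_poly_twist_bracelet [OF q(1)] q(2) *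
    by (simp only: algebra_simps mult_1_left)
qed

end
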